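(* Let $M=(E,r)$ be a matroid whose finite ground set $E$ is endowed with a linear ordering relation, and let $\mathscr{B}$ denote the set of broken circuits of $M$. Then $$\beta(M)=(-1)^{r(E)}\sum_{\substack{A\subseteq E\\ \forall B\in\mathscr{B}:\,B\not\subseteq A}} (-1)^{|A|}\,r(A)=(-1)^{r(E)}\sum_{k=1}^{|E|}(-1)^k\,k\,b_k(M),$$ where $b_k(M)$ denotes the number of $k$-subsets of $E$ including no broken circuit of $M$ as a subset.
   Context: A matroid is a pair $M=(E,r)$ consisting of a finite set $E$ and a $\mathbb{Z}$-valued function $r$ on $2^E$ such that for any $A,B\subseteq E$: (i) $0\le r(A)\le|A|$; (ii) $A\subseteq B\Rightarrow r(A)\le r(B)$; (iii) $r(A\cup B)+r(A\cap B)\le r(A)+r(B)$. A circuit of $M$ is a non-empty subset $C\subseteq E$ such that $r(C\setminus\{c\})=|C|-1=r(C)$ for any $c\in C$. Given a linear order on $E$, a broken circuit of $M$ is a set of the form $C\setminus\{\max C\}$ where $C$ is a circuit of $M$. The beta invariant of $M$ is $\beta(M)=(-1)^{r(E)}\sum_{A\subseteq E}(-1)^{|A|}r(A)$. *)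

theory Defs
  imports Main
begin

text \<open>
  The rank function is total as a HOL function; only its values on subsets of \<open>E\<close> are
  constrained, and only those are used below.
\<close>

locale matroid =
  fixes E :: "'a set" and r :: "'a set \<Rightarrow> int"
  assumes finite_ground: "finite E"
    and rank_nonneg: "A \<subseteq> E \<Longrightarrow> 0 \<le> r A"
    and rank_le_card: "A \<subseteq> E \<Longrightarrow> r A \<le> int (card A)"
    and rank_mono: "A \<subseteq> B \<Longrightarrow> B \<subseteq> E \<Longrightarrow> r A \<le> r B"
    and rank_submodular: "A \<subseteq> E \<Longrightarrow> B \<subseteq> E \<Longrightarrow> r (A \<union> B) + r (A \<inter> B) \<le> r A + r B"

definition circuit :: "'a set \<Rightarrow> ('a set \<Rightarrow> int) \<Rightarrow> 'a set \<Rightarrow> bool" where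
  "circuit E r C \<longleftrightarrow> C \<subseteq> E \<and> C \<noteq> {} \<and>
     (\<forall>c\<in>C. r (C - {c}) = int (card C) - 1 \<and> int (card C) - 1 = r C)"

text \<open>
  The pair \<open>(x, y) \<in> R\<close> means that \<open>x\<close> is at most \<open>y\<close>.
  A loop \<open>c\<close> gives the circuit \<open>{c}\<close>, whose broken circuit is the empty set.
\<close>

definition is_maximum :: "'a rel \<Rightarrow> 'a set \<Rightarrow> 'a \<Rightarrow> bool" where
  "is_maximum R C m \<longleftrightarrow> m \<in> C \<and> (\<forall>x\<in>C. (x, m) \<in> R)"

definition broken_circuits :: "'a set \<Rightarrow> ('a set \<Rightarrow> int) \<Rightarrow> 'a rel \<Rightarrow> 'a set set" where
  "broken_circuits E r R = {C - {m} | C m. circuit E r C \<and> is_maximum R C m}"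

text \<open>
  In the exponent, \<open>nat\<close> loses nothing: the rank of a matroid is nonnegative.
\<close>

definition beta_invariant :: "'a set \<Rightarrow> ('a set \<Rightarrow> int) \<Rightarrow> int" where
  "beta_invariant E r = (- 1) ^ nat (r E) * (\<Sum>A\<in>Pow E. (- 1) ^ card A * r A)"

definition num_nbc_sets :: "'a set \<Rightarrow> ('a set \<Rightarrow> int) \<Rightarrow> 'a rel \<Rightarrow> nat \<Rightarrow> nat" where
  "num_nbc_sets E r R k =
     card {A. A \<subseteq> E \<and> card A = k \<and> (\<forall>B\<in>broken_circuits E r R. \<not> B \<subseteq> A)}"

end

theory Submission
  imports Defs
begin

text \<open>
  For the first one, the terms of all sets containing a broken circuit cancel in pairs. Call \<open>m\<close> a
  completing element of \<open>A\<close> if \<open>m\<close> is the maximum of a circuit \<open>C\<close> with \<open>C - {m} \<subseteq> A\<close>; the set \<open>A\<close>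
  contains a broken circuit iff it has a completing element. Pair \<open>A\<close> with the set obtained by
  inserting or deleting its \<^emph>\<open>least\<close> completing element \<open>m\<close>. Every circuit with a maximum at most
  \<open>m\<close> lies, apart from its maximum, strictly below \<open>m\<close>, so whether it completes \<open>A\<close> cannot depend on the
  membership of \<open>m\<close> in \<open>A\<close>. Hence the partner of \<open>A\<close> has the same least completing element
  (\<open>least_completing_cong\<close>), and the pairing is an involution. It changes the cardinality by one, but
  not the rank, because \<open>m\<close> lies in the closure of \<open>C - {m}\<close> (\<open>rank_insert_circuit_element\<close>).

  For the second one, a set \<open>A\<close> without broken circuits contains no circuit either, as every circuit
  contains its broken circuit; so \<open>A\<close> is independent and \<open>r A = |A|\<close> (\<open>dependent_imp_circuit\<close>).
\<close>

section \<open>Completing elements and toggling\<close>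

definition completing :: "'a set \<Rightarrow> ('a set \<Rightarrow> int) \<Rightarrow> 'a rel \<Rightarrow> 'a set \<Rightarrow> 'a set" where
  "completing E r R A = {m. \<exists>C. circuit E r C \<and> is_maximum R C m \<and> C - {m} \<subseteq> A}"

text \<open>Least elements are maxima of the converse order, which gives both from one existence lemma.\<close>

abbreviation least_completing ::
    "'a set \<Rightarrow> ('a set \<Rightarrow> int) \<Rightarrow> 'a rel \<Rightarrow> 'a set \<Rightarrow> 'a \<Rightarrow> bool" where
  "least_completing E r R A \<equiv> is_maximum (R\<inverse>) (completing E r R A)"

definition toggle :: "'a \<Rightarrow> 'a set \<Rightarrow> 'a set" where
  "toggle m A = (if m \<in> A then A - {m} else insert m A)"

lemma toggle_toggle [simp]: "toggle m (toggle m A) = A"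
  by (auto simp: toggle_def)

lemma toggle_minus [simp]: "toggle m A - {m} = A - {m}"
  by (auto simp: toggle_def)

lemma sum_eq_0_if_sign_reversing_involution:
  fixes f :: "'b \<Rightarrow> int"
  assumes "\<And>x. x \<in> S \<Longrightarrow> t x \<in> S" "\<And>x. x \<in> S \<Longrightarrow> t (t x) = x" "\<And>x. x \<in> S \<Longrightarrow> f (t x) = - f x"
  shows "sum f S = 0"
proof -
  have "sum f S = (\<Sum>x\<in>S. - f x)"
    by (rule sum.reindex_bij_witness[where i = t and j = t]) (use assms in auto)
  then show ?thesis
    by (simp add: sum_negf)
qed

lemma linear_order_on_imp_is_maximum:
  assumes lin: "linear_order_on E R" and "finite S" "S \<noteq> {}" "S \<subseteq> E"
  shows "\<exists>m. is_maximum R S m"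
  using assms(2-)
proof (induction S rule: finite_ne_induct)
  case (singleton x)
  then show ?case
    using lin by (auto simp: is_maximum_def order_on_defs refl_on_def)
next
  case (insert x S)
  then obtain m where m: "m \<in> S" "\<forall>y\<in>S. (y, m) \<in> R"
    by (auto simp: is_maximum_def)
  have refl: "(x, x) \<in> R" and tr: "trans R"
    using lin insert.prems by (auto simp: order_on_defs refl_on_def)
  have "x \<noteq> m \<and> x \<in> E \<and> m \<in> E"
    using insert m by auto
  then consider "(x, m) \<in> R" | "(m, x) \<in> R"
    using lin by (auto simp: order_on_defs total_on_def)
  then show ?case
  proof cases
    case 1
    then show ?thesis using m by (auto simp: is_maximum_def)
  next
    case 2
    then have "\<forall>y\<in>insert x S. (y, x) \<in> R"
      using m refl tr by (auto dest: transD)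
    then show ?thesis by (auto simp: is_maximum_def)
  qed
qed

lemma contains_broken_circuit_iff:
  "(\<exists>B\<in>broken_circuits E r R. B \<subseteq> A) \<longleftrightarrow> completing E r R A \<noteq> {}"
  by (auto simp: broken_circuits_def completing_def)

lemma completing_subset: "completing E r R A \<subseteq> E"
  by (auto simp: completing_def circuit_def is_maximum_def)

text \<open>
  Deciding whether some \<open>m' \<le> m\<close> is completing never requires looking at \<open>m\<close> itself: \<open>m\<close> is either
  the maximum that gets removed from the circuit, or too large to be in it. This is what makes the
  least completing element, unlike for instance the greatest, stable under toggling.
\<close>

lemma completing_cong_below:
  assumes "antisym R" "A - {m} = B - {m}" "(m', m) \<in> R"
  shows "m' \<in> completing E r R A \<longleftrightarrow> m' \<in> completing E r R B"
proof -
  have "C - {m'} \<subseteq> A \<longleftrightarrow> C - {m'} \<subseteq> B" if "is_maximum R C m'" for C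
  proof -
    have "m \<notin> C - {m'}"
      using that assms(1,3) by (auto simp: is_maximum_def antisym_def)
    then show ?thesis
      using assms(2) by blast
  qed
  then show ?thesis
    by (auto simp: completing_def)
qed

lemma least_completing_cong:
  assumes lin: "linear_order_on E R" and eq: "A - {m} = B - {m}"
    and least: "least_completing E r R A m"
  shows "least_completing E r R B m"
proof -
  have anti: "antisym R" and tot: "total_on E R"
    using lin by (auto simp: order_on_defs)
  have mA: "m \<in> completing E r R A"
    and le: "\<And>x. x \<in> completing E r R A \<Longrightarrow> (m, x) \<in> R"
    using least by (auto simp: is_maximum_def)
  note cong = completing_cong_below[OF anti eq, where E = E and r = r]
  have "m \<in> E"
    using mA completing_subset[of E r R A] by blast
  have refl: "(m, m) \<in> R"
    using le mA by blast
  have "(m, x) \<in> R" if x: "x \<in> completing E r R B" for x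
  proof (cases "(x, m) \<in> R")
    case True
    then show ?thesis
      using x cong le by blast
  next
    case False
    moreover have "x \<in> E"
      using x completing_subset[of E r R B] by blast
    ultimately show ?thesis
      using tot refl \<open>m \<in> E\<close> by (auto simp: total_on_def)
  qed
  moreover have "m \<in> completing E r R B"
    using cong[OF refl] mA by simp
  ultimately show ?thesis
    by (auto simp: is_maximum_def)
qed

section \<open>Ranks, circuits and cancellation\<close>

context matroid
begin

text \<open>
  Submodularity of \<open>C\<close> and \<open>A - {m}\<close>, whose intersection \<open>C - {m}\<close> has the same rank as \<open>C\<close>.
\<close>

lemma rank_insert_circuit_element:
  assumes C: "circuit E r C" "m \<in> C" "C - {m} \<subseteq> A" and A: "A \<subseteq> E"
  shows "r (insert m A) = r (A - {m})"
proof (rule antisym)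
  have CE: "C \<subseteq> E" and rC: "r (C - {m}) = r C"
    using C by (auto simp: circuit_def)
  have "C \<union> (A - {m}) = insert m A" "C \<inter> (A - {m}) = C - {m}"
    using C by auto
  then show "r (insert m A) \<le> r (A - {m})"
    using rank_submodular[of C "A - {m}"] CE A rC by auto
  show "r (A - {m}) \<le> r (insert m A)"
    by (rule rank_mono) (use A C CE in auto)
qed

lemma signed_rank_toggle:
  assumes A: "A \<subseteq> E" and m: "m \<in> completing E r R A"
  shows "(- 1) ^ card (toggle m A) * r (toggle m A) = - ((- 1) ^ card A * r A)"
proof -
  obtain C where C: "circuit E r C" "m \<in> C" "C - {m} \<subseteq> A"
    using m by (auto simp: completing_def is_maximum_def)
  have rank: "r (insert m A) = r (A - {m})"
    by (rule rank_insert_circuit_element[OF C A])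
  have fin: "finite A"
    using A finite_ground finite_subset by blast
  show ?thesis
  proof (cases "m \<in> A")
    case True
    have "(- 1) ^ card A = - ((- 1 :: int) ^ card (A - {m}))"
      by (subst card.remove[OF fin True]) simp
    then show ?thesis
      using rank True by (simp only: toggle_def insert_absorb if_True)
  next
    case False
    then show ?thesis
      using rank fin by (simp add: toggle_def)
  qed
qed

lemma dependent_imp_circuit:
  assumes "A \<subseteq> E" "r A < int (card A)"
  shows "\<exists>C\<subseteq>A. circuit E r C"
proof -
  have "finite A"
    using assms(1) finite_ground finite_subset by blast
  then show ?thesis
    using assms
  proof (induction A rule: finite_psubset_induct)
    case (psubset A)
    show ?case
    proof (cases "\<exists>B. B \<subset> A \<and> r B < int (card B)")
      case True
      then obtain B where B: "B \<subset> A" "r B < int (card B)"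
        by blast
      then have "\<exists>C\<subseteq>B. circuit E r C"
        using psubset.IH[of B] psubset.prems(1) by blast
      then show ?thesis
        using B(1) by blast
    next
      \<comment> \<open>A minimal dependent set is a circuit.\<close>
      case False
      have "r (A - {c}) = int (card A) - 1 \<and> int (card A) - 1 = r A" if c: "c \<in> A" for c
      proof -
        have "A - {c} \<subset> A"
          using c by blast
        then have "int (card (A - {c})) \<le> r (A - {c})"
          using False by (meson not_less)
        moreover have "r (A - {c}) \<le> int (card (A - {c}))"
          by (rule rank_le_card) (use psubset.prems(1) in blast)
        moreover have "card A = Suc (card (A - {c}))"
          by (rule card.remove[OF psubset.hyps c])
        moreover have "r (A - {c}) \<le> r A"
          by (rule rank_mono) (use psubset.prems(1) in auto)
        ultimately show ?thesis
          using psubset.prems by linarith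
      qed
      moreover have "A \<noteq> {}"
        using psubset.prems rank_nonneg[of A] by auto
      ultimately have "circuit E r A"
        using psubset.prems by (auto simp: circuit_def)
      then show ?thesis by blast
    qed
  qed
qed

lemma rank_eq_card_if_no_broken_circuit:
  assumes lin: "linear_order_on E R" and A: "A \<subseteq> E"
    and nbc: "\<forall>B\<in>broken_circuits E r R. \<not> B \<subseteq> A"
  shows "r A = int (card A)"
proof (rule ccontr)
  assume "r A \<noteq> int (card A)"
  then have "r A < int (card A)"
    using rank_le_card[OF A] by simp
  then obtain C where C: "C \<subseteq> A" "circuit E r C"
    using dependent_imp_circuit[OF A] by blast
  then have "C \<noteq> {}" "C \<subseteq> E" "finite C"
    using finite_subset[OF _ finite_ground] by (auto simp: circuit_def)
  then obtain m where "is_maximum R C m"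
    using linear_order_on_imp_is_maximum[OF lin] by blast
  then have "C - {m} \<in> broken_circuits E r R"
    using C by (auto simp: broken_circuits_def)
  then show False
    using nbc C by blast
qed

lemma sum_signed_rank_broken_eq_0:
  assumes lin: "linear_order_on E R"
  shows "(\<Sum>A | A \<subseteq> E \<and> (\<exists>B\<in>broken_circuits E r R. B \<subseteq> A). (- 1) ^ card A * r A) = 0"
proof -
  let ?S = "{A. A \<subseteq> E \<and> (\<exists>B\<in>broken_circuits E r R. B \<subseteq> A)}"
  define piv where "piv A = (THE m. least_completing E r R A m)" for A
  have uniq: "piv A = m" if "least_completing E r R A m" for A m
    unfolding piv_def
    using that lin by (intro the_equality) (auto simp: is_maximum_def order_on_defs antisym_def)
  have piv: "least_completing E r R A (piv A)" if "A \<in> ?S" for A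
  proof -
    have "linear_order_on E (R\<inverse>)"
      using lin by simp
    moreover have "completing E r R A \<noteq> {}"
      using that contains_broken_circuit_iff by blast
    ultimately obtain m where "least_completing E r R A m"
      using linear_order_on_imp_is_maximum[of E "R\<inverse>" "completing E r R A"]
        finite_subset[OF completing_subset[of E r R A] finite_ground]
        completing_subset[of E r R A] by blast
    then show ?thesis
      using uniq by simp
  qed
  have toggled: "least_completing E r R (toggle (piv A) A) (piv A)" if "A \<in> ?S" for A
    by (rule least_completing_cong[OF lin _ piv[OF that]]) simp
  show ?thesis
  proof (rule sum_eq_0_if_sign_reversing_involution[where t = "\<lambda>A. toggle (piv A) A"])
    fix A assume A: "A \<in> ?S"
    have mem: "piv A \<in> completing E r R A" "piv A \<in> completing E r R (toggle (piv A) A)"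
      using piv[OF A] toggled[OF A] unfolding is_maximum_def by blast+
    have "piv A \<in> E"
      by (rule subsetD[OF completing_subset mem(1)])
    then have "toggle (piv A) A \<subseteq> E"
      using A by (auto simp: toggle_def)
    then show "toggle (piv A) A \<in> ?S"
      using mem(2) contains_broken_circuit_iff[of E r R "toggle (piv A) A"] by blast
    show "toggle (piv (toggle (piv A) A)) (toggle (piv A) A) = A"
      using uniq[OF toggled[OF A]] by simp
    show "(- 1) ^ card (toggle (piv A) A) * r (toggle (piv A) A) = - ((- 1) ^ card A * r A)"
      using signed_rank_toggle[OF _ mem(1)] A by simp
  qed
qed

end

section \<open>The beta invariant\<close>

lemma sum_by_card:
  fixes g :: "nat \<Rightarrow> int"
  assumes fin: "finite E"
  shows "(\<Sum>A | A \<subseteq> E \<and> P A. g (card A)) =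
    (\<Sum>k\<le>card E. g k * int (card {A. A \<subseteq> E \<and> card A = k \<and> P A}))"
proof -
  have "card ` {A. A \<subseteq> E \<and> P A} \<subseteq> {..card E}"
    using fin by (auto intro: card_mono)
  moreover have "finite {A. A \<subseteq> E \<and> P A}"
    using fin by simp
  ultimately have "(\<Sum>A | A \<subseteq> E \<and> P A. g (card A)) =
      (\<Sum>k\<le>card E. \<Sum>A\<in>{A \<in> {A. A \<subseteq> E \<and> P A}. card A = k}. g (card A))"
    by (intro sum.group[symmetric]) auto
  also have "\<dots> = (\<Sum>k\<le>card E. g k * int (card {A. A \<subseteq> E \<and> card A = k \<and> P A}))"
  proof (rule sum.cong[OF refl])
    fix k
    have "{A \<in> {A. A \<subseteq> E \<and> P A}. card A = k} = {A. A \<subseteq> E \<and> card A = k \<and> P A}"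
      by auto
    then show "(\<Sum>A\<in>{A \<in> {A. A \<subseteq> E \<and> P A}. card A = k}. g (card A)) =
        g k * int (card {A. A \<subseteq> E \<and> card A = k \<and> P A})"
      by simp
  qed
  finally show ?thesis .
qed

theorem mainTheorem4:
  fixes E :: "'a set" and r :: "'a set \<Rightarrow> int" and R :: "'a rel"
  assumes "matroid E r"
    and "linear_order_on E R"
  shows "beta_invariant E r =
           (- 1) ^ nat (r E) *
             (\<Sum>A | A \<subseteq> E \<and> (\<forall>B\<in>broken_circuits E r R. \<not> B \<subseteq> A). (- 1) ^ card A * r A)
       \<and> (- 1) ^ nat (r E) *
             (\<Sum>A | A \<subseteq> E \<and> (\<forall>B\<in>broken_circuits E r R. \<not> B \<subseteq> A). (- 1) ^ card A * r A)
         = (- 1) ^ nat (r E) *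
             (\<Sum>k = 1..card E. (- 1) ^ k * int k * int (num_nbc_sets E r R k))"
proof -
  interpret matroid E r by fact
  let ?nbc = "\<lambda>A. \<forall>B\<in>broken_circuits E r R. \<not> B \<subseteq> A"
  let ?N = "{A. A \<subseteq> E \<and> ?nbc A}"
  let ?S = "{A. A \<subseteq> E \<and> (\<exists>B\<in>broken_circuits E r R. B \<subseteq> A)}"
  let ?f = "\<lambda>A. (- 1) ^ card A * r A"
  have "sum ?f (Pow E) = sum ?f (?N \<union> ?S)"
    by (rule sum.cong) auto
  also have "\<dots> = sum ?f ?N + sum ?f ?S"
    by (rule sum.union_disjoint) (use finite_ground in auto)
  finally have first: "sum ?f (Pow E) = sum ?f ?N"
    using sum_signed_rank_broken_eq_0[OF assms(2)] by simp
  have "sum ?f ?N = (\<Sum>A | A \<subseteq> E \<and> ?nbc A. (- 1) ^ card A * int (card A))"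
    by (rule sum.cong) (use rank_eq_card_if_no_broken_circuit[OF assms(2)] in auto)
  also have "\<dots> = (\<Sum>k\<le>card E. (- 1) ^ k * int k * int (num_nbc_sets E r R k))"
    unfolding num_nbc_sets_def by (rule sum_by_card[OF finite_ground])
  also have "\<dots> = (\<Sum>k = 1..card E. (- 1) ^ k * int k * int (num_nbc_sets E r R k))"
    by (rule sum.mono_neutral_right) (auto simp: not_le)
  finally show ?thesis
    using first by (simp add: beta_invariant_def)
qed

end
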